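(* Let $n\ge 2$, let $\theta_1,\dots,\theta_n>0$, and let $H:\mathbb{R}_+^n\to\mathbb{R}_+^n$ be the quadratic operator $H(x)=x'$ with $$x_k'=\frac{\theta_k x_k}{2}\Big(x_k+2\sum_{i\ne k}x_i\Big),\qquad k=1,\dots,n.$$ Then the following statements hold: (a) the fixed point $(0,0,\dots,0)$ is attracting; (b) for any $i=1,\dots,n$ the fixed point $(0,\dots,0,\tfrac{2}{\theta_i},0,\dots,0)$ (non-zero entry in position $i$) is nonhyperbolic if $\theta_i=2\theta_j$ for some $j\ne i$; repelling if $\theta_i<2\theta_j$ for all $j\ne i$; and a saddle otherwise; (c) if $\theta_i\theta=\frac{2n-1}{2}$ for some $i\in\{1,\dots,n\}$, where $\theta=\sum_{j=1}^n\frac1{\theta_j}$, then the fixed point $(\overline{x}_1,\dots,\overline{x}_n)$ is a nonhyperbolic fixed point, where $$\overline{x}_i=\frac{4\theta_i\sum_{1\le i_1<\dots<i_{n-2}\le n,\ i_j\ne i}\theta_{i_1}\cdots\theta_{i_{n-2}}-(4n-6)\prod_{j\ne i}\theta_j}{(2n-1)\prod_{j=1}^n\theta_j},\qquad i=1,\dots,n;$$ (d) if $\theta_i\widetilde{\theta}=\frac{2(n-r)-1}{2}$ for some $i\in\{1,\dots,n\}$, where $\widetilde{\theta}=\sum_{j=r+1}^n\frac{1}{\theta_{s_j}}$, then the fixed point with $r$ zero coordinates $\widetilde{x}_{s_1},\dots,\widetilde{x}_{s_r}$ and $n-r$ non-zero coordinates $\widetilde{x}_{s_{r+1}},\dots,\widetilde{x}_{s_n}$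 is a nonhyperbolic fixed point, where for $i=r+1,\dots,n$ $$\widetilde{x}_{s_i}=\frac{4\theta_{s_i}\sum_{r+1\le i_1<\dots<i_{n-r-2}\le n,\ i_j\ne i}\theta_{s_{i_1}}\cdots\theta_{s_{i_{n-r-2}}}-(4(n-r)-6)\prod_{r+1\le j\le n,\ j\ne i}\theta_{s_j}}{(2(n-r)-1)\prod_{j=r+1}^n\theta_{s_j}}.$$
   Context: $\mathbb{R}_+^n=\{x\in\mathbb{R}^n: x_i\ge 0 \text{ for all } i\}$. In (d), $s_1,\dots,s_n$ is an enumeration of the indices $1,\dots,n$. Types of fixed points are the usual ones, read off from the eigenvalues of the Jacobian matrix of $H$ at the point: nonhyperbolic if some eigenvalue has absolute value $1$; otherwise attracting if all eigenvalues have absolute value less than $1$, repelling if all have absolute value greater than $1$, and a saddle if both kinds occur. In (b), "otherwise" means that neither of the two preceding conditions holds. When $n-2=0$ (resp. $n-r-2=0$) the sum in the formula consists of the single empty product, equal to $1$. *)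

theory Defs
  imports "HOL-Analysis.Analysis"
begin

definition nonneg_orthant :: "(real ^ 'n) set" where
  "nonneg_orthant = {x. \<forall>i. 0 \<le> x $ i}"

text \<open>The operator is given on the whole space, so that its Jacobian matrix also makes sense at
  boundary points of the orthant; the lemma below shows that it restricts to a self-map of the
  orthant.\<close>

definition quad_op :: "('n::finite \<Rightarrow> real) \<Rightarrow> real ^ 'n \<Rightarrow> real ^ 'n" where
  "quad_op \<theta> x = (\<chi> k. \<theta> k * x $ k / 2 * (x $ k + 2 * (\<Sum>i\<in>UNIV - {k}. x $ i)))"

lemma quad_op_nonneg_orthant:
  assumes "\<And>k. \<theta> k > 0" and "x \<in> nonneg_orthant"
  shows "quad_op \<theta> x \<in> nonneg_orthant"
  using assms unfolding nonneg_orthant_def quad_op_def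
  by (auto intro!: mult_nonneg_nonneg divide_nonneg_nonneg add_nonneg_nonneg sum_nonneg
      simp: less_imp_le)

text \<open>A real matrix is viewed as a complex one, so that non-real eigenvalues count.\<close>

definition eigenvalues :: "real ^ 'n ^ 'n \<Rightarrow> complex set" where
  "eigenvalues A = {\<mu>. \<exists>v. v \<noteq> 0 \<and> map_matrix complex_of_real A *v v = \<mu> *s v}"

definition jacobian_eigenvalues :: "(real ^ 'n \<Rightarrow> real ^ 'n) \<Rightarrow> real ^ 'n \<Rightarrow> complex set" where
  "jacobian_eigenvalues f x = eigenvalues (jacobian f (at x))"

definition nonhyperbolic_fixed_point :: "(real ^ 'n \<Rightarrow> real ^ 'n) \<Rightarrow> real ^ 'n \<Rightarrow> bool" where
  "nonhyperbolic_fixed_point f x \<longleftrightarrow>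
     f x = x \<and> (\<exists>\<mu>\<in>jacobian_eigenvalues f x. norm \<mu> = 1)"

definition attracting_fixed_point :: "(real ^ 'n \<Rightarrow> real ^ 'n) \<Rightarrow> real ^ 'n \<Rightarrow> bool" where
  "attracting_fixed_point f x \<longleftrightarrow>
     f x = x \<and> (\<forall>\<mu>\<in>jacobian_eigenvalues f x. norm \<mu> < 1)"

definition repelling_fixed_point :: "(real ^ 'n \<Rightarrow> real ^ 'n) \<Rightarrow> real ^ 'n \<Rightarrow> bool" where
  "repelling_fixed_point f x \<longleftrightarrow>
     f x = x \<and> (\<forall>\<mu>\<in>jacobian_eigenvalues f x. norm \<mu> > 1)"

definition saddle_fixed_point :: "(real ^ 'n \<Rightarrow> real ^ 'n) \<Rightarrow> real ^ 'n \<Rightarrow> bool" where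
  "saddle_fixed_point f x \<longleftrightarrow>
     f x = x \<and> (\<forall>\<mu>\<in>jacobian_eigenvalues f x. norm \<mu> \<noteq> 1) \<and>
     (\<exists>\<mu>\<in>jacobian_eigenvalues f x. norm \<mu> < 1) \<and>
     (\<exists>\<mu>\<in>jacobian_eigenvalues f x. norm \<mu> > 1)"

text \<open>Strictly increasing index tuples of length \<open>m\<close> are encoded as index sets of cardinality
  \<open>m\<close>. The point need not lie in the orthant, but it is a fixed point of \<open>quad_op \<theta>\<close>
  in any case.\<close>

definition xbar :: "('n::finite \<Rightarrow> real) \<Rightarrow> real ^ 'n" where
  "xbar \<theta> = (\<chi> i.
     (4 * \<theta> i * (\<Sum>J | J \<subseteq> UNIV - {i} \<and> card J = CARD('n) - 2. \<Prod>j\<in>J. \<theta> j)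
        - (4 * real CARD('n) - 6) * (\<Prod>j\<in>UNIV - {i}. \<theta> j))
     / ((2 * real CARD('n) - 1) * (\<Prod>j\<in>UNIV. \<theta> j)))"

text \<open>The coordinate with index \<open>s i\<close>, where \<open>i \<in> {r + 1..n}\<close>, of the fixed point vanishing at
  \<open>s 1, \<dots>, s r\<close>. The cardinality \<open>n - r - 2\<close> is written without truncated subtraction: for
  \<open>r = n - 1\<close> the sum is empty and the value is \<open>2 / \<theta> (s n)\<close>.\<close>

definition xtilde_coord :: "('n::finite \<Rightarrow> real) \<Rightarrow> (nat \<Rightarrow> 'n) \<Rightarrow> nat \<Rightarrow> nat \<Rightarrow> real" where
  "xtilde_coord \<theta> s r i =
     (4 * \<theta> (s i) *
          (\<Sum>J | J \<subseteq> {r + 1..CARD('n)} - {i} \<and> card J + r + 2 = CARD('n). \<Prod>j\<in>J. \<theta> (s j))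
        - (4 * (real CARD('n) - real r) - 6) * (\<Prod>j\<in>{r + 1..CARD('n)} - {i}. \<theta> (s j)))
     / ((2 * (real CARD('n) - real r) - 1) * (\<Prod>j\<in>{r + 1..CARD('n)}. \<theta> (s j)))"

end

theory Submission
  imports Defs
begin

text \<open>Writing \<open>S\<close> for the coordinate sum of \<open>x\<close>, the \<open>k\<close>-th coordinate of \<open>quad_op \<theta> x\<close> is
  \<open>\<theta>\<^sub>k x\<^sub>k (S - x\<^sub>k / 2)\<close>, and the Jacobian matrix sends \<open>v\<close> to the vector with coordinates
  \<open>\<theta>\<^sub>k (v\<^sub>k (S - x\<^sub>k) + x\<^sub>k \<Sum>v)\<close>. Its spectrum can be read off at the origin and at the points on the
  axes. At the remaining fixed points, with support contained in \<open>A\<close> and \<open>m = |A|\<close>, one has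
  \<open>x\<^sub>k = 2 S - 2 / \<theta>\<^sub>k\<close> for \<open>k \<in> A\<close>, so that \<open>(2 m - 1) S = 2 (\<Sum>k\<in>A. 1 / \<theta>\<^sub>k)\<close>. The
  hypothesis of (c) and (d) says precisely that \<open>S = 1 / \<theta>\<^sub>i\<close>; then \<open>x\<^sub>i = 0\<close> and the \<open>i\<close>-th row of
  the Jacobian matrix is that of the identity, so 1 is an eigenvalue.\<close>

section \<open>Derivative of the operator and its eigenvector equations\<close>

lemma quad_op_nth:
  "quad_op \<theta> x $ k = \<theta> k * x $ k * ((\<Sum>i\<in>UNIV. x $ i) - x $ k / 2)"
proof -
  have "(\<Sum>i\<in>UNIV. x $ i) = x $ k + (\<Sum>i\<in>UNIV - {k}. x $ i)"
    by (simp add: sum.remove)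
  then show ?thesis by (simp add: quad_op_def algebra_simps)
qed

lemma quad_op_has_derivative:
  "(quad_op \<theta> has_derivative
     (\<lambda>v. \<chi> k. \<theta> k * (v $ k * ((\<Sum>i\<in>UNIV. x $ i) - x $ k) + x $ k * (\<Sum>i\<in>UNIV. v $ i)))) (at x)"
proof -
  have "((\<lambda>y. \<theta> k * y $ k * ((\<Sum>i\<in>UNIV. y $ i) - y $ k / 2)) has_derivative
     (\<lambda>v. \<theta> k * (v $ k * ((\<Sum>i\<in>UNIV. x $ i) - x $ k) + x $ k * (\<Sum>i\<in>UNIV. v $ i)))) (at x)" for k
    by (auto intro!: derivative_eq_intros bounded_linear_imp_has_derivative bounded_linear_vec_nth
        simp: algebra_simps)
  then have "((\<lambda>y. \<chi> k. \<theta> k * y $ k * ((\<Sum>i\<in>UNIV. y $ i) - y $ k / 2)) has_derivative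
     (\<lambda>v. \<chi> k. \<theta> k * (v $ k * ((\<Sum>i\<in>UNIV. x $ i) - x $ k) + x $ k * (\<Sum>i\<in>UNIV. v $ i)))) (at x)"
    by (subst has_derivative_componentwise_within)
      (auto simp: Basis_vec_def inner_axis)
  moreover have "(\<lambda>y. \<chi> k. \<theta> k * y $ k * ((\<Sum>i\<in>UNIV. y $ i) - y $ k / 2)) = quad_op \<theta>"
    by (simp add: fun_eq_iff vec_eq_iff quad_op_nth)
  ultimately show ?thesis by simp
qed

lemma jacobian_quad_op_nth:
  "jacobian (quad_op \<theta>) (at x) $ k $ j =
     \<theta> k * ((if j = k then (\<Sum>i\<in>UNIV. x $ i) - x $ k else 0) + x $ k)"
proof -
  have "(\<Sum>i\<in>UNIV. axis j 1 $ i) = (1 :: real)"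
    by (simp add: axis_def)
  then show ?thesis
    unfolding jacobian_def
      frechet_derivative_at[OF quad_op_has_derivative[of \<theta> x], symmetric]
    by (simp add: matrix_def axis_def)
qed

text \<open>The Jacobian matrix is diagonal plus rank one, so the coordinate equations are coupled
  only through the sum of the entries of \<open>v\<close>. This lets the spectrum be handled without
  determinants.\<close>

lemma jacobian_eigenvalues_quad_op:
  "\<mu> \<in> jacobian_eigenvalues (quad_op \<theta>) x \<longleftrightarrow>
     (\<exists>v. v \<noteq> 0 \<and> (\<forall>k. of_real (\<theta> k) *
        (v $ k * of_real ((\<Sum>i\<in>UNIV. x $ i) - x $ k) + of_real (x $ k) * (\<Sum>i\<in>UNIV. v $ i))
        = \<mu> * v $ k))"
proof -
  have "(map_matrix complex_of_real (jacobian (quad_op \<theta>) (at x)) *v v) $ k =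
     of_real (\<theta> k) *
        (v $ k * of_real ((\<Sum>i\<in>UNIV. x $ i) - x $ k) + of_real (x $ k) * (\<Sum>i\<in>UNIV. v $ i))"
    (is "_ = ?r") for v k
  proof -
    have "(map_matrix complex_of_real (jacobian (quad_op \<theta>) (at x)) *v v) $ k =
      (\<Sum>j\<in>UNIV. (if j = k then of_real (\<theta> k) * of_real ((\<Sum>i\<in>UNIV. x $ i) - x $ k) * v $ j else 0)
         + of_real (\<theta> k * x $ k) * v $ j)"
      unfolding matrix_vector_mult_def map_matrix_def
      by (auto simp: jacobian_quad_op_nth algebra_simps intro!: sum.cong)
    also have "\<dots> = of_real (\<theta> k) * of_real ((\<Sum>i\<in>UNIV. x $ i) - x $ k) * v $ k
         + of_real (\<theta> k * x $ k) * (\<Sum>j\<in>UNIV. v $ j)"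
      by (simp add: sum.distrib sum_distrib_left)
    also have "\<dots> = ?r" by (simp add: algebra_simps)
    finally show ?thesis .
  qed
  then show ?thesis
    by (simp add: jacobian_eigenvalues_def eigenvalues_def vec_eq_iff)
qed

text \<open>Row \<open>i\<close> of the Jacobian matrix minus the identity vanishes, so this linear
  map \<open>L\<close> misses \<open>axis i 1\<close>. In finite dimension it is then not injective,
  and a nonzero real kernel vector, read as a complex one, is the eigenvector.\<close>

lemma one_in_jacobian_eigenvalues_quad_op:
  assumes "x $ i = 0" and "\<theta> i * (\<Sum>j\<in>UNIV. x $ j) = 1"
  shows "1 \<in> jacobian_eigenvalues (quad_op \<theta>) x"
proof -
  let ?D = "\<lambda>v :: real ^ 'a. \<chi> k. \<theta> k * (v $ k * ((\<Sum>i\<in>UNIV. x $ i) - x $ k)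
      + x $ k * (\<Sum>i\<in>UNIV. v $ i))"
  define L where "L = (\<lambda>v. ?D v - v)"
  have lin: "linear L"
    unfolding L_def
    by (rule linear_compose_sub[OF has_derivative_linear[OF quad_op_has_derivative] linear_ident])
  have L_i: "L v $ i = 0" for v
    using assms by (simp add: L_def algebra_simps)
  have "axis i 1 \<notin> range L"
  proof
    assume "axis i 1 \<in> range L"
    then obtain v where "axis i 1 = L v" by blast
    then show False using L_i[of v] by (metis axis_nth zero_neq_one)
  qed
  then have "\<not> inj L" using linear_injective_imp_surjective[OF lin] by blast
  then obtain v where "v \<noteq> 0" "L v = 0"
    using linear_injective_0[OF lin] by blast
  then have "?D v $ k = v $ k" for k by (simp add: L_def)
  then have "of_real (?D v $ k) = complex_of_real (v $ k)" for k by simp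
  moreover have "(\<chi> k. complex_of_real (v $ k)) \<noteq> 0"
    using \<open>v \<noteq> 0\<close> by (simp add: vec_eq_iff)
  ultimately show ?thesis
    unfolding jacobian_eigenvalues_quad_op
    by (intro exI[of _ "\<chi> k. complex_of_real (v $ k)"]) simp
qed

section \<open>Spectrum at the origin and on the axes\<close>

lemma attracting_quad_op_0: "attracting_fixed_point (quad_op \<theta>) 0"
proof -
  have "\<mu> = 0" if "\<mu> \<in> jacobian_eigenvalues (quad_op \<theta>) 0" for \<mu>
    using that by (auto simp: jacobian_eigenvalues_quad_op vec_eq_iff)
  then show ?thesis
    by (force simp: attracting_fixed_point_def vec_eq_iff quad_op_nth)
qed

lemma quad_op_axis:
  assumes "\<theta> i \<noteq> 0"
  shows "quad_op \<theta> (axis i (2 / \<theta> i)) = axis i (2 / \<theta> i)"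
  using assms by (simp add: vec_eq_iff quad_op_nth axis_def)

text \<open>Here the coordinate sum equals the \<open>i\<close>-th coordinate
  \<open>2 / \<theta> i\<close>. Hence every entry of row \<open>i\<close> is 2, while each row
  \<open>k\<close> other than \<open>i\<close> has only its diagonal entry
  \<open>2 * \<theta> k / \<theta> i\<close>. With \<open>i\<close> listed first the matrix is
  triangular, and the spectrum is its diagonal.\<close>

lemma jacobian_eigenvalues_quad_op_axis:
  assumes "\<theta> i \<noteq> 0"
  shows "jacobian_eigenvalues (quad_op \<theta>) (axis i (2 / \<theta> i)) =
     insert 2 ((\<lambda>k. of_real (2 * \<theta> k / \<theta> i)) ` (UNIV - {i}))"
proof -
  have eig: "\<mu> \<in> jacobian_eigenvalues (quad_op \<theta>) (axis i (2 / \<theta> i)) \<longleftrightarrow>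
     (\<exists>v. v \<noteq> 0 \<and> 2 * (\<Sum>j\<in>UNIV. v $ j) = \<mu> * v $ i \<and>
        (\<forall>k. k \<noteq> i \<longrightarrow> of_real (2 * \<theta> k / \<theta> i) * v $ k = \<mu> * v $ k))" for \<mu>
  proof -
    have "(of_real (\<theta> k) * (v $ k * of_real ((\<Sum>j\<in>UNIV. axis i (2 / \<theta> i) $ j) - axis i (2 / \<theta> i) $ k)
          + of_real (axis i (2 / \<theta> i) $ k) * (\<Sum>j\<in>UNIV. v $ j)) = \<mu> * v $ k) \<longleftrightarrow>
       (if k = i then 2 * (\<Sum>j\<in>UNIV. v $ j) = \<mu> * v $ i
        else of_real (2 * \<theta> k / \<theta> i) * v $ k = \<mu> * v $ k)" for v :: "complex ^ 'a" and k
      using assms by (simp add: axis_def algebra_simps)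
    then show ?thesis
      unfolding jacobian_eigenvalues_quad_op by (auto split: if_splits)
  qed
  have 2: "2 \<in> jacobian_eigenvalues (quad_op \<theta>) (axis i (2 / \<theta> i))"
    unfolding eig by (intro exI[of _ "axis i 1"]) (auto simp: axis_def vec_eq_iff)
  show ?thesis
  proof (intro equalityI subsetI)
    fix \<mu> assume "\<mu> \<in> jacobian_eigenvalues (quad_op \<theta>) (axis i (2 / \<theta> i))"
    then obtain v where v: "v \<noteq> 0" "2 * (\<Sum>j\<in>UNIV. v $ j) = \<mu> * v $ i"
      "\<And>k. k \<noteq> i \<Longrightarrow> of_real (2 * \<theta> k / \<theta> i) * v $ k = \<mu> * v $ k"
      unfolding eig by blast
    show "\<mu> \<in> insert 2 ((\<lambda>k. of_real (2 * \<theta> k / \<theta> i)) ` (UNIV - {i}))"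
    \<comment> \<open>A nonzero coordinate away from \<open>i\<close> can be cancelled in its own
      row; otherwise \<open>v\<close> is supported at \<open>i\<close>, and row \<open>i\<close>
      forces the eigenvalue 2.\<close>
    proof (cases "\<exists>k. k \<noteq> i \<and> v $ k \<noteq> 0")
      case True
      then obtain k where k: "k \<noteq> i" "v $ k \<noteq> 0" by blast
      then have "\<mu> = of_real (2 * \<theta> k / \<theta> i)"
        using v(3)[of k] by (metis mult_right_cancel)
      then show ?thesis using k(1) by blast
    next
      case False
      then have "(\<Sum>j\<in>UNIV. v $ j) = v $ i"
        by (subst sum.remove[of _ i]) (auto intro!: sum.neutral)
      moreover have "v $ i \<noteq> 0"
        using False v(1) by (metis vec_eq_iff zero_index)
      ultimately show ?thesis using v(2) by simp
    qed
  next
    fix \<mu> :: complex assume "\<mu> \<in> insert 2 ((\<lambda>k. of_real (2 * \<theta> k / \<theta> i)) ` (UNIV - {i}))"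
    then consider "\<mu> = 2" | k where "\<mu> \<noteq> 2" "k \<noteq> i" "\<mu> = of_real (2 * \<theta> k / \<theta> i)"
      by blast
    then show "\<mu> \<in> jacobian_eigenvalues (quad_op \<theta>) (axis i (2 / \<theta> i))"
    proof cases
      case 1
      then show ?thesis using 2 by simp
    next
      case k: 2
      \<comment> \<open>The entry \<open>t\<close> at \<open>i\<close> solves row \<open>i\<close>,
        that is \<open>2 * (1 + t) = \<mu> * t\<close>; the value 2 was split off to make this
        solvable.\<close>
      let ?v = "axis k 1 + axis i (2 / (\<mu> - 2))"
      have "(\<Sum>j\<in>UNIV. ?v $ j) = 1 + 2 / (\<mu> - 2)"
        by (simp add: sum.distrib axis_def)
      then have "2 * (\<Sum>j\<in>UNIV. ?v $ j) = \<mu> * ?v $ i"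
        using k by (simp add: axis_def field_simps)
      moreover have "?v $ k \<noteq> 0" using k by (simp add: axis_def)
      moreover have "of_real (2 * \<theta> j / \<theta> i) * ?v $ j = \<mu> * ?v $ j" if "j \<noteq> i" for j
        using that k by (simp add: axis_def)
      ultimately show ?thesis
        unfolding eig by (metis zero_index)
    qed
  qed
qed

section \<open>Closed form of the coordinates\<close>

text \<open>A subset one element short of \<open>B\<close> is \<open>B - {j}\<close> for a unique
  \<open>j\<close>, and its product is the full product divided by \<open>w j\<close>. Writing
  \<open>card J + 1 = card B\<close> keeps the case of empty \<open>B\<close> right: both sides are
  then 0.\<close>

lemma sum_prod_card_pred:
  fixes w :: "'a \<Rightarrow> 'b::field"
  assumes "finite B" and "\<And>j. j \<in> B \<Longrightarrow> w j \<noteq> 0"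
  shows "(\<Sum>J | J \<subseteq> B \<and> card J + 1 = card B. \<Prod>j\<in>J. w j) = (\<Prod>j\<in>B. w j) * (\<Sum>j\<in>B. 1 / w j)"
proof -
  have eq: "{J. J \<subseteq> B \<and> card J + 1 = card B} = (\<lambda>j. B - {j}) ` B"
  proof (intro equalityI subsetI)
    fix J assume "J \<in> {J. J \<subseteq> B \<and> card J + 1 = card B}"
    then have J: "J \<subseteq> B" "card J + 1 = card B" by auto
    then have "card (B - J) = 1"
      using assms(1) by (simp add: card_Diff_subset finite_subset)
    then obtain j where "B - J = {j}" by (auto simp: card_1_singleton_iff)
    then have "j \<in> B" "J = B - {j}" using J(1) by auto
    then show "J \<in> (\<lambda>j. B - {j}) ` B" by blast
  next
    fix J assume "J \<in> (\<lambda>j. B - {j}) ` B"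
    then show "J \<in> {J. J \<subseteq> B \<and> card J + 1 = card B}"
      using assms(1) card_Suc_Diff1 by fastforce
  qed
  have "inj_on (\<lambda>j. B - {j}) B" by (auto simp: inj_on_def)
  then have "(\<Sum>J | J \<subseteq> B \<and> card J + 1 = card B. \<Prod>j\<in>J. w j) = (\<Sum>j\<in>B. \<Prod>l\<in>B - {j}. w l)"
    unfolding eq by (simp add: sum.reindex)
  also have "\<dots> = (\<Sum>j\<in>B. (\<Prod>l\<in>B. w l) * (1 / w j))"
  proof (rule sum.cong)
    fix j assume "j \<in> B"
    then show "(\<Prod>l\<in>B - {j}. w l) = (\<Prod>l\<in>B. w l) * (1 / w j)"
      using assms by (simp add: prod.remove[of B j])
  qed simp
  finally show ?thesis by (simp add: sum_distrib_left)
qed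

text \<open>Common simplification of \<open>xbar\<close> and \<open>xtilde_coord\<close>: the inner
  sum is the product over \<open>A - {i}\<close> times the sum of reciprocals there, so that product
  cancels from the quotient. For \<open>A = {i}\<close> the inner sum is empty.\<close>

lemma fixed_point_coordinate:
  fixes w :: "'a \<Rightarrow> real"
  assumes "finite A" and "i \<in> A" and "\<And>j. j \<in> A \<Longrightarrow> w j \<noteq> 0"
  shows "(4 * w i * (\<Sum>J | J \<subseteq> A - {i} \<and> card J + 2 = card A. \<Prod>j\<in>J. w j)
        - (4 * real (card A) - 6) * (\<Prod>j\<in>A - {i}. w j))
     / ((2 * real (card A) - 1) * (\<Prod>j\<in>A. w j))
     = 4 * (\<Sum>j\<in>A. 1 / w j) / (2 * real (card A) - 1) - 2 / w i"
proof -
  define P where "P = (\<Prod>j\<in>A - {i}. w j)"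
  define T where "T = (\<Sum>j\<in>A - {i}. 1 / w j)"
  define m where "m = real (card A)"
  have "card A = card (A - {i}) + 1"
    using assms card_Suc_Diff1[of A i] by simp
  then have "{J. J \<subseteq> A - {i} \<and> card J + 2 = card A} =
      {J. J \<subseteq> A - {i} \<and> card J + 1 = card (A - {i})}" by auto
  then have "(\<Sum>J | J \<subseteq> A - {i} \<and> card J + 2 = card A. \<Prod>j\<in>J. w j) = P * T"
    unfolding P_def T_def using assms sum_prod_card_pred[of "A - {i}" w] by simp
  moreover have "(\<Prod>j\<in>A. w j) = w i * P" "(\<Sum>j\<in>A. 1 / w j) = 1 / w i + T"
    unfolding P_def T_def using assms by (simp_all add: prod.remove sum.remove)
  moreover have "P \<noteq> 0" "w i \<noteq> 0"
    unfolding P_def using assms by auto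
  moreover have "2 * m - 1 \<noteq> 0"
    using \<open>card A = card (A - {i}) + 1\<close> unfolding m_def by simp
  ultimately show ?thesis
    unfolding P_def[symmetric] m_def[symmetric] by (simp add: divide_simps) algebra
qed

section \<open>Fixed points with prescribed support\<close>

text \<open>The common core of (c) and (d), with \<open>A\<close> containing the support. The index
  \<open>i\<close> may lie inside or outside \<open>A\<close>.\<close>

lemma nonhyperbolic_quad_op_support:
  fixes \<theta> :: "'n::finite \<Rightarrow> real"
  assumes pos: "\<And>k. \<theta> k > 0" and "A \<noteq> {}"
    and cond: "\<theta> i * (\<Sum>j\<in>A. 1 / \<theta> j) = (2 * real (card A) - 1) / 2"
    and out: "\<And>k. k \<notin> A \<Longrightarrow> x $ k = 0"
    and ins: "\<And>k. k \<in> A \<Longrightarrow> x $ k = 4 * (\<Sum>j\<in>A. 1 / \<theta> j) / (2 * real (card A) - 1) - 2 / \<theta> k"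
  shows "nonhyperbolic_fixed_point (quad_op \<theta>) x"
proof -
  define m where "m = real (card A)"
  define T where "T = (\<Sum>j\<in>A. 1 / \<theta> j)"
  have "m \<ge> 1"
    using \<open>A \<noteq> {}\<close> unfolding m_def by (simp add: Suc_leI card_gt_0_iff)
  have "\<theta> i \<noteq> 0" using pos[of i] by simp
  have T: "T = (2 * m - 1) / (2 * \<theta> i)"
    using cond \<open>\<theta> i \<noteq> 0\<close> unfolding T_def m_def by (simp add: field_simps)
  then have "4 * T / (2 * m - 1) = 2 / \<theta> i"
    using \<open>m \<ge> 1\<close> \<open>\<theta> i \<noteq> 0\<close> by (simp add: field_simps)
  then have xA: "x $ k = 2 / \<theta> i - 2 / \<theta> k" if "k \<in> A" for k
    using ins[OF that] unfolding T_def m_def by simp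
  have "(\<Sum>j\<in>UNIV. x $ j) = (\<Sum>j\<in>A. x $ j)"
    using out by (intro sum.mono_neutral_right) auto
  also have "\<dots> = (\<Sum>j\<in>A. 2 / \<theta> i - 2 * (1 / \<theta> j))"
    using xA by (intro sum.cong) auto
  also have "\<dots> = m * (2 / \<theta> i) - 2 * T"
    unfolding m_def T_def sum_subtractf sum_distrib_left by simp
  also have "\<dots> = 1 / \<theta> i"
    using \<open>\<theta> i \<noteq> 0\<close> unfolding T by (simp add: field_simps)
  finally have S: "(\<Sum>j\<in>UNIV. x $ j) = 1 / \<theta> i" .
  have "quad_op \<theta> x $ k = x $ k" for k
  proof (cases "k \<in> A")
    case True
    \<comment> \<open>The factor \<open>\<theta> k * (S - x $ k / 2)\<close> is 1, since
      \<open>S = 1 / \<theta> i\<close> and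
      \<open>x $ k = 2 / \<theta> i - 2 / \<theta> k\<close>.\<close>
    then show ?thesis
      using pos[of k] by (simp add: quad_op_nth S xA diff_divide_distrib)
  qed (simp add: quad_op_nth out)
  \<comment> \<open>Inside \<open>A\<close> the two fractions in \<open>xA\<close> cancel; outside
    \<open>A\<close> the coordinate vanishes by \<open>out\<close>.\<close>
  moreover have "x $ i = 0" using xA[of i] out[of i] by auto
  then have "1 \<in> jacobian_eigenvalues (quad_op \<theta>) x"
    by (rule one_in_jacobian_eigenvalues_quad_op) (simp add: S \<open>\<theta> i \<noteq> 0\<close>)
  ultimately show ?thesis
    by (auto simp: nonhyperbolic_fixed_point_def vec_eq_iff intro!: bexI[of _ 1])
qed

lemma xbar_nth:
  fixes \<theta> :: "'n::finite \<Rightarrow> real"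
  assumes "CARD('n) \<ge> 2" and "\<And>k. \<theta> k \<noteq> 0"
  shows "xbar \<theta> $ k = 4 * (\<Sum>j\<in>UNIV. 1 / \<theta> j) / (2 * real CARD('n) - 1) - 2 / \<theta> k"
proof -
  \<comment> \<open>The truncated subtraction is exact because the dimension is at least 2.\<close>
  have "(card J = CARD('n) - 2) = (card J + 2 = CARD('n))" for J :: "'n set"
    using assms(1) by auto
  then show ?thesis
    using fixed_point_coordinate[of UNIV k \<theta>] assms(2) by (simp add: xbar_def)
qed

lemma xtilde_coord_eq:
  fixes \<theta> :: "'n::finite \<Rightarrow> real"
  assumes "r < CARD('n)" and "i \<in> {r + 1..CARD('n)}" and "\<And>k. \<theta> k \<noteq> 0"
  shows "xtilde_coord \<theta> s r i =
     4 * (\<Sum>j = r + 1..CARD('n). 1 / \<theta> (s j)) / (2 * (real CARD('n) - real r) - 1) - 2 / \<theta> (s i)"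
proof -
  let ?A = "{r + 1..CARD('n)}"
  have card: "card ?A + r = CARD('n)"
    using assms(1) by simp
  then have m: "real (card ?A) = real CARD('n) - real r" by linarith
  have "(card J + r + 2 = CARD('n)) = (card J + 2 = card ?A)" for J :: "nat set"
    using card by linarith
  then show ?thesis
    using fixed_point_coordinate[of ?A i "\<lambda>j. \<theta> (s j)"] assms(2,3)
    unfolding xtilde_coord_def m by simp
qed

section \<open>Classification of the fixed points\<close>

theorem proposition7:
  fixes \<theta> :: "'n::finite \<Rightarrow> real"
  assumes "CARD('n) \<ge> 2"
    and "\<And>k. \<theta> k > 0"
  shows
    "((0 :: real ^ 'n) \<in> nonneg_orthant \<and> attracting_fixed_point (quad_op \<theta>) 0)
     \<and>
     (\<forall>i. axis i (2 / \<theta> i) \<in> nonneg_orthant \<and>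
        ((\<exists>j. j \<noteq> i \<and> \<theta> i = 2 * \<theta> j) \<longrightarrow>
           nonhyperbolic_fixed_point (quad_op \<theta>) (axis i (2 / \<theta> i))) \<and>
        ((\<forall>j. j \<noteq> i \<longrightarrow> \<theta> i < 2 * \<theta> j) \<longrightarrow>
           repelling_fixed_point (quad_op \<theta>) (axis i (2 / \<theta> i))) \<and>
        (\<not> (\<exists>j. j \<noteq> i \<and> \<theta> i = 2 * \<theta> j) \<and> \<not> (\<forall>j. j \<noteq> i \<longrightarrow> \<theta> i < 2 * \<theta> j) \<longrightarrow>
           saddle_fixed_point (quad_op \<theta>) (axis i (2 / \<theta> i))))
     \<and>
     ((\<exists>i. \<theta> i * (\<Sum>j\<in>UNIV. 1 / \<theta> j) = (2 * real CARD('n) - 1) / 2) \<longrightarrow>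
        nonhyperbolic_fixed_point (quad_op \<theta>) (xbar \<theta>))
     \<and>
     (\<forall>s r x. bij_betw s {1..CARD('n)} (UNIV :: 'n set) \<and> r < CARD('n) \<and>
        (\<exists>i. \<theta> i * (\<Sum>j = r + 1..CARD('n). 1 / \<theta> (s j))
              = (2 * (real CARD('n) - real r) - 1) / 2) \<and>
        (\<forall>i\<in>{1..r}. x $ s i = 0) \<and>
        (\<forall>i\<in>{r + 1..CARD('n)}. x $ s i = xtilde_coord \<theta> s r i) \<longrightarrow>
        nonhyperbolic_fixed_point (quad_op \<theta>) x)"
proof (intro conjI allI impI)
  note pos = assms(2)
  have nz: "\<theta> k \<noteq> 0" for k using pos[of k] by simp
  show "(0 :: real ^ 'n) \<in> nonneg_orthant" by (simp add: nonneg_orthant_def)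
  show "attracting_fixed_point (quad_op \<theta>) 0" by (rule attracting_quad_op_0)
  show "axis i (2 / \<theta> i) \<in> nonneg_orthant" for i
    using pos[of i] by (simp add: nonneg_orthant_def axis_def)
  note fixed = quad_op_axis[of \<theta>, OF nz] and eig = jacobian_eigenvalues_quad_op_axis[of \<theta>, OF nz]
  \<comment> \<open>The eigenvalue 2 always has modulus above 1, so the type in (b) depends only on
    how these ratios compare with 1.\<close>
  have norm_eig: "norm (complex_of_real (2 * \<theta> k / \<theta> i)) = 2 * \<theta> k / \<theta> i" for i k
    using pos[of i] pos[of k] by (simp only: norm_of_real) simp
  show "nonhyperbolic_fixed_point (quad_op \<theta>) (axis i (2 / \<theta> i))"
    if "\<exists>j. j \<noteq> i \<and> \<theta> i = 2 * \<theta> j" for i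
  proof -
    from that obtain j where j: "j \<noteq> i" "\<theta> i = 2 * \<theta> j" by blast
    then have "2 * \<theta> j / \<theta> i = 1" using nz[of j] by simp
    then show ?thesis
      unfolding nonhyperbolic_fixed_point_def eig
      using fixed[of i] norm_eig[of j i] j(1)
      by (intro conjI bexI[of _ "complex_of_real (2 * \<theta> j / \<theta> i)"]) auto
  qed
  show "repelling_fixed_point (quad_op \<theta>) (axis i (2 / \<theta> i))"
    if "\<forall>j. j \<noteq> i \<longrightarrow> \<theta> i < 2 * \<theta> j" for i
  proof -
    have "1 < 2 * \<theta> j / \<theta> i" if "j \<noteq> i" for j
      using \<open>\<forall>j. j \<noteq> i \<longrightarrow> \<theta> i < 2 * \<theta> j\<close> that pos[of i] by simp
    then show ?thesis
      unfolding repelling_fixed_point_def eig using fixed norm_eig[of _ i] by auto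
  qed
  show "saddle_fixed_point (quad_op \<theta>) (axis i (2 / \<theta> i))"
    if saddle: "\<not> (\<exists>j. j \<noteq> i \<and> \<theta> i = 2 * \<theta> j) \<and> \<not> (\<forall>j. j \<noteq> i \<longrightarrow> \<theta> i < 2 * \<theta> j)" for i
  proof -
    have neq: "2 * \<theta> j / \<theta> i \<noteq> 1" if "j \<noteq> i" for j
      using saddle that nz[of i] by auto
    have "norm \<mu> \<noteq> 1" if "\<mu> \<in> jacobian_eigenvalues (quad_op \<theta>) (axis i (2 / \<theta> i))" for \<mu>
    proof -
      from that consider "\<mu> = 2" | k where "k \<noteq> i" "\<mu> = of_real (2 * \<theta> k / \<theta> i)"
        unfolding eig by blast
      then show ?thesis
      proof cases
        case k: 2
        show ?thesis unfolding k(2) norm_eig by (rule neq[OF k(1)])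
      qed simp
    qed
    \<comment> \<open>Some \<open>j\<close> violates the repelling condition, and equality is
      excluded; it yields the contracting direction, the eigenvalue 2 the expanding one.\<close>
    moreover obtain j where j: "j \<noteq> i" "2 * \<theta> j < \<theta> i"
      using saddle by (meson linorder_neqE_linordered_idom)
    then have "2 * \<theta> j / \<theta> i < 1" using pos[of i] by simp
    then have "\<exists>\<mu>\<in>jacobian_eigenvalues (quad_op \<theta>) (axis i (2 / \<theta> i)). norm \<mu> < 1"
      unfolding eig using norm_eig[of j i] j(1)
      by (intro bexI[of _ "complex_of_real (2 * \<theta> j / \<theta> i)"]) auto
    moreover have "\<exists>\<mu>\<in>jacobian_eigenvalues (quad_op \<theta>) (axis i (2 / \<theta> i)). norm \<mu> > 1"
      unfolding eig by (intro bexI[of _ 2]) auto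
    ultimately show ?thesis
      unfolding saddle_fixed_point_def using fixed by blast
  qed
  show "nonhyperbolic_fixed_point (quad_op \<theta>) (xbar \<theta>)"
    if "\<exists>i. \<theta> i * (\<Sum>j\<in>UNIV. 1 / \<theta> j) = (2 * real CARD('n) - 1) / 2"
    using that nonhyperbolic_quad_op_support[of \<theta> UNIV _ "xbar \<theta>", OF pos]
      xbar_nth[OF assms(1) nz] by auto
  show "nonhyperbolic_fixed_point (quad_op \<theta>) x"
    if h: "bij_betw s {1..CARD('n)} (UNIV :: 'n set) \<and> r < CARD('n) \<and>
        (\<exists>i. \<theta> i * (\<Sum>j = r + 1..CARD('n). 1 / \<theta> (s j))
              = (2 * (real CARD('n) - real r) - 1) / 2) \<and>
        (\<forall>i\<in>{1..r}. x $ s i = 0) \<and>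
        (\<forall>i\<in>{r + 1..CARD('n)}. x $ s i = xtilde_coord \<theta> s r i)" for s r x
  proof -
    let ?I = "{r + 1..CARD('n)}"
    from h obtain i where i: "\<theta> i * (\<Sum>j\<in>?I. 1 / \<theta> (s j)) = (2 * (real CARD('n) - real r) - 1) / 2"
      by blast
    have r: "r < CARD('n)" using h by blast
    have inj: "inj_on s ?I"
      using h by (auto simp: bij_betw_def intro: inj_on_subset)
    then have "card (s ` ?I) = CARD('n) - r"
      by (simp add: card_image)
    then have card: "real (card (s ` ?I)) = real CARD('n) - real r" using r by simp
    have sum: "(\<Sum>j\<in>s ` ?I. 1 / \<theta> j) = (\<Sum>j\<in>?I. 1 / \<theta> (s j))"
      using inj by (simp add: sum.reindex)
    have surj: "\<exists>j\<in>{1..CARD('n)}. k = s j" for k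
      using h by (metis UNIV_I bij_betw_def imageE)
    show ?thesis
    \<comment> \<open>The support set is the image of the last \<open>n - r\<close> positions;
      injectivity of \<open>s\<close> transports its sum and cardinality.\<close>
    proof (rule nonhyperbolic_quad_op_support[of \<theta> "s ` ?I" i, OF pos])
      show "s ` ?I \<noteq> {}" using r by simp
      show "\<theta> i * (\<Sum>j\<in>s ` ?I. 1 / \<theta> j) = (2 * real (card (s ` ?I)) - 1) / 2"
        unfolding sum card by (rule i)
      show "x $ k = 0" if "k \<notin> s ` ?I" for k
      proof -
        \<comment> \<open>By surjectivity of \<open>s\<close>, an index outside the image comes from
          one of the first \<open>r\<close> positions.\<close>
        obtain j where "j \<in> {1..CARD('n)}" "k = s j" using surj by blast
        with that have "j \<in> {1..r}" by (auto simp: not_le)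
        with h \<open>k = s j\<close> show ?thesis by blast
      qed
      show "x $ k = 4 * (\<Sum>j\<in>s ` ?I. 1 / \<theta> j) / (2 * real (card (s ` ?I)) - 1) - 2 / \<theta> k"
        if "k \<in> s ` ?I" for k
        using that h xtilde_coord_eq[OF r _ nz] unfolding sum card by auto
    qed
  qed
qed

end
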